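(* Let $\alpha,\gamma,\kappa>-1$ be real numbers with $\alpha+\kappa>-\frac32$, and let $\{p_{n,k}^{\alpha,\gamma,\kappa}(x,y):\ n,k\in\mathbb{N}_0\}$ be the monic symmetric orthogonal basis associated with $w_{\alpha,\gamma,\kappa}$. Then, for all $n,k\in\mathbb{N}_0$, \[ \mathcal{D}_{1}^{\alpha,\gamma,\kappa}\big[p_{n,k}^{\alpha,\gamma,\kappa}(x,y)\big]=\lambda_{n,k}^{\alpha,\gamma,\kappa}\,p_{n,k}^{\alpha,\gamma,\kappa}(x,y), \] where \[ \lambda_{n,k}^{\alpha,\gamma,\kappa}=-(n+2k)(n+2k+2\alpha+2\kappa+\gamma+3). \]
   Context: All polynomials have real coefficients; symmetric means invariant under interchange of $x$ and $y$. Let $\mathbf{T}^2=\{(x,y)\in\mathbb{R}^2:\ x\ge0,\ y\ge0,\ x+y\le1\}$, $\triangle=\{(x,y)\in\mathbf{T}^2:\ y<x\}$, and \[ w_{\alpha,\gamma,\kappa}(x,y)=(xy)^{\alpha}(1-x-y)^{\gamma}|x-y|^{2\kappa+1}. \] Order on $\mathbb{N}_0^2$ (with $\mathbb{N}_0$ the nonnegative integers): $(m,l)\prec(n,k)$ if and only if $m+2l<n+2k$, or $m+2l=n+2k$ and $l<k$; this is a strict total order. Every symmetric polynomial is uniquely a finite linear combination of the monomials $(x+y)^n(xy)^k$; the largest pair $(n,k)$ (for $\prec$) occurring with nonzero coefficient is its symmetric degree. Monic orthogonal basis: $p_{n,k}^{\alpha,\gamma,\kappa}$ is obtained by Gram--Schmidt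 (without normalization of norms, with leading coefficient $1$) from the monomials $(x+y)^n(xy)^k$ ordered by $\prec$; i.e. it is the unique symmetric polynomial equal to $(x+y)^n(xy)^k$ plus a linear combination of $(x+y)^m(xy)^l$ with $(m,l)\prec(n,k)$, and satisfying $\int_{\triangle}p_{n,k}^{\alpha,\gamma,\kappa}\,q\,w_{\alpha,\gamma,\kappa}\,dx\,dy=0$ for every symmetric polynomial $q$ of symmetric degree $\prec(n,k)$. Operator: \[ \begin{aligned} \mathcal{D}_{1}^{\alpha,\gamma,\kappa}&=x(1-x)\partial_x^2-2xy\,\partial_x\partial_y+y(1-y)\partial_y^2\\ &\quad+\left[\alpha+1-(2\alpha+\gamma+2\kappa+4)x\right]\partial_x+\left[\alpha+1-(2\alpha+\gamma+2\kappa+4)y\right]\partial_y\\ &\quad+(2\kappa+1)\frac{x\partial_x-y\partial_y}{x-y}. \end{aligned} \] When applied to a symmetric polynomial $p$, the numerator $x\partial_xp-y\partial_yp$ is divisible by $x-y$, so $\mathcal{D}_{1}^{\alpha,\gamma,\kappa}p$ is a polynomial. *)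

theory Defs
  imports "HOL-Analysis.Analysis" "HOL-Computational_Algebra.Polynomial"
begin

text \<open>
  Bivariate real polynomials are elements of \<open>real poly poly\<close>, i.e. of \<open>R[y][x]\<close>:
  the outer variable is \<open>x\<close>, the inner one is \<open>y\<close>.
\<close>

type_synonym bipoly = "real poly poly"

definition eval2 :: "bipoly \<Rightarrow> real \<Rightarrow> real \<Rightarrow> real" where
  "eval2 p x y = poly (poly p [:x:]) y"

definition varX :: bipoly where "varX = [:0, 1:]"
definition varY :: bipoly where "varY = [:[:0, 1:]:]"
definition const2 :: "real \<Rightarrow> bipoly" where "const2 c = [:[:c:]:]"

definition dx :: "bipoly \<Rightarrow> bipoly" where "dx p = pderiv p"
definition dy :: "bipoly \<Rightarrow> bipoly" where "dy p = map_poly pderiv p"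

definition symmetric2 :: "bipoly \<Rightarrow> bool" where
  "symmetric2 p \<longleftrightarrow> (\<forall>x y. eval2 p x y = eval2 p y x)"

definition sdeg_less :: "nat \<times> nat \<Rightarrow> nat \<times> nat \<Rightarrow> bool" (infix "\<prec>" 50) where
  "sdeg_less = (\<lambda>(m, l) (n, k). m + 2 * l < n + 2 * k \<or> (m + 2 * l = n + 2 * k \<and> l < k))"

definition sym_monom :: "nat \<times> nat \<Rightarrow> bipoly" where
  "sym_monom = (\<lambda>(n, k). (varX + varY) ^ n * (varX * varY) ^ k)"

definition sym_expansion :: "bipoly \<Rightarrow> (nat \<times> nat \<Rightarrow> real) \<Rightarrow> bool" where
  "sym_expansion p c \<longleftrightarrow>
     finite {i. c i \<noteq> 0} \<and> p = (\<Sum>i | c i \<noteq> 0. const2 (c i) * sym_monom i)"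

text \<open>
  A relation rather than a function, since the zero polynomial has no symmetric degree.
\<close>

definition has_sym_degree :: "bipoly \<Rightarrow> nat \<times> nat \<Rightarrow> bool" where
  "has_sym_degree p d \<longleftrightarrow>
     (\<exists>c. sym_expansion p c \<and> c d \<noteq> 0 \<and> (\<forall>i. c i \<noteq> 0 \<longrightarrow> i = d \<or> i \<prec> d))"

definition T2 :: "(real \<times> real) set" where
  "T2 = {(x, y). 0 \<le> x \<and> 0 \<le> y \<and> x + y \<le> 1}"

definition half_triangle :: "(real \<times> real) set" where
  "half_triangle = {(x, y). (x, y) \<in> T2 \<and> y < x}"

text \<open>
  Where a base is \<open>0\<close>, \<open>powr\<close> yields \<open>0\<close> irrespective of the exponent; on the domain of
  integration this concerns only a Lebesgue null set.
\<close>

definition weight :: "real \<Rightarrow> real \<Rightarrow> real \<Rightarrow> real \<Rightarrow> real \<Rightarrow> real" where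
  "weight \<alpha> \<gamma> \<kappa> x y =
     (x * y) powr \<alpha> * (1 - x - y) powr \<gamma> * \<bar>x - y\<bar> powr (2 * \<kappa> + 1)"

definition w_inner :: "real \<Rightarrow> real \<Rightarrow> real \<Rightarrow> bipoly \<Rightarrow> bipoly \<Rightarrow> real" where
  "w_inner \<alpha> \<gamma> \<kappa> p q =
     (LINT (x, y):half_triangle|lborel. eval2 p x y * eval2 q x y * weight \<alpha> \<gamma> \<kappa> x y)"

definition is_monic_sop :: "real \<Rightarrow> real \<Rightarrow> real \<Rightarrow> nat \<Rightarrow> nat \<Rightarrow> bipoly \<Rightarrow> bool" where
  "is_monic_sop \<alpha> \<gamma> \<kappa> n k p \<longleftrightarrow>
     symmetric2 p \<and>
     (\<exists>c. sym_expansion (p - sym_monom (n, k)) c \<and> (\<forall>i. c i \<noteq> 0 \<longrightarrow> i \<prec> (n, k))) \<and>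
     (\<forall>q d. symmetric2 q \<and> has_sym_degree q d \<and> d \<prec> (n, k) \<longrightarrow> w_inner \<alpha> \<gamma> \<kappa> p q = 0)"

definition monic_sop :: "real \<Rightarrow> real \<Rightarrow> real \<Rightarrow> nat \<Rightarrow> nat \<Rightarrow> bipoly" where
  "monic_sop \<alpha> \<gamma> \<kappa> n k = (THE p. is_monic_sop \<alpha> \<gamma> \<kappa> n k p)"

text \<open>
  The last summand uses \<open>div\<close> of the ring \<open>real poly poly\<close>. It is the exact quotient whenever
  the numerator is a multiple of \<open>varX - varY\<close>, which for symmetric \<open>p\<close> is lemma
  \<open>diff_dvd_numerator\<close> below; on other polynomials the value of the operator is not meaningful.
\<close>

definition D1 :: "real \<Rightarrow> real \<Rightarrow> real \<Rightarrow> bipoly \<Rightarrow> bipoly" where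
  "D1 \<alpha> \<gamma> \<kappa> p =
     varX * (1 - varX) * dx (dx p) - 2 * varX * varY * dx (dy p) + varY * (1 - varY) * dy (dy p)
     + (const2 (\<alpha> + 1) - const2 (2 * \<alpha> + \<gamma> + 2 * \<kappa> + 4) * varX) * dx p
     + (const2 (\<alpha> + 1) - const2 (2 * \<alpha> + \<gamma> + 2 * \<kappa> + 4) * varY) * dy p
     + const2 (2 * \<kappa> + 1) * ((varX * dx p - varY * dy p) div (varX - varY))"

lemma eval2_mult: "eval2 (p * q) x y = eval2 p x y * eval2 q x y"
  by (simp add: eval2_def)

lemma eval2_diff: "eval2 (p - q) x y = eval2 p x y - eval2 q x y"
  by (simp add: eval2_def)

lemma eval2_varX: "eval2 varX x y = x"
  by (simp add: eval2_def varX_def)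

lemma eval2_varY: "eval2 varY x y = y"
  by (simp add: eval2_def varY_def)

lemma dx_pCons: "dx (pCons a p) = p + varX * dx p"
  by (simp add: dx_def varX_def pderiv_pCons)

lemma dy_pCons: "dy (pCons a p) = pCons (pderiv a) (dy p)"
  by (simp add: dy_def map_poly_pCons)

lemma eval2_pCons: "eval2 (pCons a p) x y = poly a y + x * eval2 p x y"
  by (simp add: eval2_def)

lemma DERIV_eval2_x: "((\<lambda>t. eval2 p t y) has_real_derivative eval2 (dx p) x y) (at x)"
proof (induction p)
  case 0
  show ?case by (simp add: eval2_def dx_def)
next
  case (pCons a p)
  show ?case unfolding eval2_pCons dx_pCons
    by (rule derivative_eq_intros refl pCons.IH)+ (simp add: eval2_def varX_def)
qed

lemma DERIV_eval2_y: "((\<lambda>t. eval2 p x t) has_real_derivative eval2 (dy p) x y) (at y)"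
proof (induction p)
  case 0
  show ?case by (simp add: eval2_def dy_def)
next
  case (pCons a p)
  show ?case unfolding eval2_pCons dy_pCons
    by (rule derivative_eq_intros refl pCons.IH poly_DERIV)+ simp
qed

lemma diff_dvd_numerator:
  assumes "symmetric2 p"
  shows "varX - varY dvd varX * dx p - varY * dy p"
proof -
  let ?q = "varX * dx p - varY * dy p"
  have "poly (poly ?q [:0, 1:]) y = 0" for y
  proof -
    have on_diag: "poly (poly r [:0, 1:]) y = eval2 r y y" for r :: bipoly
      by (induction r) (simp_all add: eval2_def)
    have "(\<lambda>t. eval2 p y t) = (\<lambda>t. eval2 p t y)"
      using assms by (auto simp: symmetric2_def)
    then have "eval2 (dy p) y y = eval2 (dx p) y y"
      using DERIV_eval2_y[of p y y] DERIV_eval2_x[of p y y] DERIV_unique by metis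
    then show ?thesis
      unfolding on_diag by (simp add: eval2_diff eval2_mult eval2_varX eval2_varY)
  qed
  then have "poly ?q [:0, 1:] = 0"
    using poly_all_0_iff_0 by blast
  moreover have "varX - varY = [:- [:0, 1:], 1:]"
    by (simp add: varX_def varY_def)
  ultimately show ?thesis
    using poly_eq_0_iff_dvd[of ?q "[:0, 1:]"] by metis
qed

end

(*
  In the coordinates s = x + y, z = 4xy / s^2 the weight splits into a product of two Beta weights,
  so the integral of (x+y)^n (xy)^k against it is a product of two Beta values, one depending only
  on n + 2k and one only on k.  On monomials the operator acts by
    D1 (n,k) = lambda (n,k) + n (n + 4k + 2 alpha + 2 kappa + 2) (n-1,k) + k (k + alpha) (n+1,k-1),
  hence is triangular for the order on degrees, and its self-adjointness reduces to the recurrence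
  (a + b) B(a+1,b) = a B(a,b).  So D1 p - lambda p has lower degree than the basis element p and is
  orthogonal to everything of lower degree, i.e. it vanishes.
*)
theory Submission
  imports Defs
begin

text \<open>Self-adjointness by integration by parts would meet boundary terms on edges where the
  weight may be singular, since all three exponents may be negative. Comparing moments avoids
  differentiating the weight. It suffices because the moment of a product of two monomials depends
  only on the sums of their indices: in the difference of the two sides of the symmetry relation the
  coefficients factor through the differences of n + 2k and of k, each of which multiplies one Beta
  recurrence. The condition \<alpha> + \<kappa> > -3/2 is integrability at the origin, where s
  carries the exponent 2\<alpha> + 2\<kappa> + 2 for the constant polynomial, Jacobian included.
  Since \<open>monic_sop\<close> is a definite description, existence and uniqueness come before any
  use of it; both, like the final vanishing, rest on definiteness of the inner product on
  polynomials.\<close>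

no_notation lesspoll (infixl "\<prec>" 50)

section \<open>The operator on symmetric monomials\<close>

lemma eval2_add: "eval2 (p + q) x y = eval2 p x y + eval2 q x y"
  by (simp add: eval2_def)

lemma eval2_const2: "eval2 (const2 c) x y = c"
  by (simp add: eval2_def const2_def)

lemma eval2_power: "eval2 (p ^ n) x y = eval2 p x y ^ n"
  by (simp add: eval2_def)

lemma eval2_0: "eval2 0 x y = 0" and eval2_1: "eval2 1 x y = 1"
  by (simp_all add: eval2_def)

lemma eval2_2: "eval2 2 x y = 2"
  using eval2_add[of 1 1] by (simp add: eval2_1)

lemmas eval2_simps = eval2_add eval2_diff eval2_mult eval2_power eval2_const2
  eval2_varX eval2_varY eval2_0 eval2_1 eval2_2

text \<open>As a polynomial in x over the ring of polynomials in y, a nonzero \<open>p\<close> has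
  finitely many roots, so its slice at some x in \<open>S\<close> is nonzero and has finitely many
  roots itself. \<open>T\<close> may vary with x so that a triangle is covered as well as a
  rectangle.\<close>

lemma eval2_eq_0_imp:
  assumes S: "infinite S" and T: "\<And>x. x \<in> S \<Longrightarrow> infinite (T x)"
    and zero: "\<And>x y. x \<in> S \<Longrightarrow> y \<in> T x \<Longrightarrow> eval2 p x y = 0"
  shows "p = 0"
proof (rule ccontr)
  assume "p \<noteq> 0"
  have "poly p [:x:] = 0" if "x \<in> S" for x
  proof (rule ccontr)
    assume "poly p [:x:] \<noteq> 0"
    then have "finite {y. poly (poly p [:x:]) y = 0}"
      by (rule poly_roots_finite)
    moreover have "T x \<subseteq> {y. poly (poly p [:x:]) y = 0}"
      using zero[OF that] by (auto simp: eval2_def)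
    ultimately show False
      using T[OF that] finite_subset by blast
  qed
  then have "(\<lambda>x. [:x:]) ` S \<subseteq> {z. poly p z = 0}"
    by auto
  moreover have "finite {z. poly p z = 0}"
    using \<open>p \<noteq> 0\<close> by (rule poly_roots_finite)
  ultimately have "finite ((\<lambda>x. [:x:]) ` S)"
    using finite_subset by blast
  then show False
    using S by (auto dest!: finite_imageD simp: inj_on_def)
qed

lemma eval2_eqI:
  assumes "\<And>x y. eval2 p x y = eval2 q x y"
  shows "p = q"
  using eval2_eq_0_imp[of UNIV "\<lambda>_. UNIV" "p - q"] assms
  by (simp add: eval2_diff infinite_UNIV_char_0)

text \<open>Together with \<open>eval2_eqI\<close>, this and its companion for \<open>dy\<close>
  reduce differentiation rules to real calculus; the product rule for the coefficientwise
  \<open>dy\<close> is obtained this way.\<close>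

lemma eval2_dx_eqI:
  assumes "((\<lambda>t. eval2 p t y) has_real_derivative D) (at x)"
  shows "eval2 (dx p) x y = D"
  using DERIV_unique DERIV_eval2_x assms by blast

lemma eval2_dy_eqI:
  assumes "((\<lambda>t. eval2 p x t) has_real_derivative D) (at y)"
  shows "eval2 (dy p) x y = D"
  using DERIV_unique DERIV_eval2_y assms by blast

lemma dx_add: "dx (p + q) = dx p + dx q"
  and dx_mult: "dx (p * q) = dx p * q + p * dx q"
  and dx_const2: "dx (const2 c) = 0"
  and dx_varX: "dx varX = 1" and dx_varY: "dx varY = 0"
  by (simp_all add: dx_def pderiv_add pderiv_mult const2_def varX_def varY_def pderiv_pCons mult_ac)

lemma dy_const2: "dy (const2 c) = 0" and dy_varX: "dy varX = 0" and dy_varY: "dy varY = 1"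
  by (simp_all add: dy_def const2_def varX_def varY_def map_poly_pCons pderiv_pCons)
    (simp add: one_pCons)

lemma dy_add: "dy (p + q) = dy p + dy q"
  by (rule eval2_eqI, rule eval2_dy_eqI)
    (auto simp: eval2_simps intro!: derivative_eq_intros DERIV_eval2_y)

lemma dy_mult: "dy (p * q) = dy p * q + p * dy q"
  by (rule eval2_eqI, rule eval2_dy_eqI)
    (auto simp: eval2_simps intro!: derivative_eq_intros DERIV_eval2_y)

lemma eval2_of_nat: "eval2 (of_nat n) x y = of_nat n"
  by (induction n) (auto simp: eval2_simps)

lemma dy_of_nat: "dy (of_nat n) = 0" and dx_of_nat: "dx (of_nat n) = 0"
  by (simp_all add: dy_def dx_def of_nat_poly map_poly_pCons pderiv_pCons)

lemmas d_simps = dx_add dx_mult dx_const2 dx_varX dx_varY dx_of_nat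
  dy_add dy_mult dy_const2 dy_varX dy_varY dy_of_nat

text \<open>Naming an exact quotient \<open>q\<close> removes \<open>div\<close>; the quotients of
  symmetric polynomials can then be added and scaled directly.\<close>

lemma D1_eq_quotient:
  assumes "varX * dx p - varY * dy p = (varX - varY) * q"
  shows "D1 \<alpha> \<gamma> \<kappa> p =
     varX * (1 - varX) * dx (dx p) - 2 * varX * varY * dx (dy p) + varY * (1 - varY) * dy (dy p)
     + (const2 (\<alpha> + 1) - const2 (2 * \<alpha> + \<gamma> + 2 * \<kappa> + 4) * varX) * dx p
     + (const2 (\<alpha> + 1) - const2 (2 * \<alpha> + \<gamma> + 2 * \<kappa> + 4) * varY) * dy p
     + const2 (2 * \<kappa> + 1) * q"
proof -
  have "varX - varY \<noteq> 0"
    by (simp add: varX_def varY_def)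
  then show ?thesis
    by (simp add: D1_def assms)
qed

text \<open>The shape of \<open>D1\<close> with its six coefficients abstracted to letters, so that
  linearity is proved without multiplying out the concrete coefficients.\<close>

lemma linear_combination_add:
  fixes a :: "'a :: comm_ring"
  shows "a * (p + p') - b * (q + q') + c * (r + r') + d * (s + s') + e * (t + t') + f * (u + u') =
    (a * p - b * q + c * r + d * s + e * t + f * u)
    + (a * p' - b * q' + c * r' + d * s' + e * t' + f * u')"
  by (simp add: algebra_simps)

lemma linear_combination_scale:
  fixes a :: "'a :: comm_ring"
  shows "a * (k * p) - b * (k * q) + c * (k * r) + d * (k * s) + e * (k * t) + f * (k * u) =
    k * (a * p - b * q + c * r + d * s + e * t + f * u)"
  by (simp add: algebra_simps)

lemma D1_add:
  assumes "symmetric2 p" and "symmetric2 q"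
  shows "D1 \<alpha> \<gamma> \<kappa> (p + q) = D1 \<alpha> \<gamma> \<kappa> p + D1 \<alpha> \<gamma> \<kappa> q"
proof -
  obtain u where u: "varX * dx p - varY * dy p = (varX - varY) * u"
    using diff_dvd_numerator[OF assms(1)] by blast
  obtain v where v: "varX * dx q - varY * dy q = (varX - varY) * v"
    using diff_dvd_numerator[OF assms(2)] by blast
  have uv: "varX * dx (p + q) - varY * dy (p + q) = (varX - varY) * (u + v)"
    using u v by (simp add: d_simps algebra_simps)
  show ?thesis
    unfolding D1_eq_quotient[OF u] D1_eq_quotient[OF v] D1_eq_quotient[OF uv]
    unfolding dx_add dy_add by (rule linear_combination_add)
qed

lemma D1_scale:
  assumes "symmetric2 p"
  shows "D1 \<alpha> \<gamma> \<kappa> (const2 c * p) = const2 c * D1 \<alpha> \<gamma> \<kappa> p"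
proof -
  obtain u where u: "varX * dx p - varY * dy p = (varX - varY) * u"
    using diff_dvd_numerator[OF assms] by blast
  have cu: "varX * dx (const2 c * p) - varY * dy (const2 c * p) = (varX - varY) * (const2 c * u)"
    using arg_cong[OF u, of "\<lambda>r. const2 c * r"] by (simp add: d_simps algebra_simps)
  show ?thesis
    unfolding D1_eq_quotient[OF u] D1_eq_quotient[OF cu]
    by (simp add: dx_mult dy_mult dx_const2 dy_const2 linear_combination_scale)
qed

lemma eval2_sym_monom: "eval2 (sym_monom (n, k)) x y = (x + y) ^ n * (x * y) ^ k"
  by (simp add: sym_monom_def eval2_simps)

lemma symmetric2_sym_monom: "symmetric2 (sym_monom i)"
  by (cases i) (simp add: symmetric2_def eval2_sym_monom add.commute mult.commute)

definition jacobi_eigenvalue :: "real \<Rightarrow> real \<Rightarrow> real \<Rightarrow> nat \<times> nat \<Rightarrow> real" where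
  "jacobi_eigenvalue \<alpha> \<gamma> \<kappa> = (\<lambda>(n, k).
     - (real n + 2 * real k) * (real n + 2 * real k + 2 * \<alpha> + 2 * \<kappa> + \<gamma> + 3))"

lemma dx_sym_monom: "dx (sym_monom (n, k)) =
      of_nat n * sym_monom (n - 1, k) + of_nat k * varY * sym_monom (n, k - 1)"
  and dy_sym_monom: "dy (sym_monom (n, k)) =
      of_nat n * sym_monom (n - 1, k) + of_nat k * varX * sym_monom (n, k - 1)"
  by (rule eval2_eqI, rule eval2_dx_eqI eval2_dy_eqI,
      auto simp: eval2_simps eval2_of_nat eval2_sym_monom intro!: derivative_eq_intros)+

lemma power_diff1_eq: "s * (real n * s ^ (n - 1)) = real n * s ^ n" for s :: real
  by (cases n) simp_all

text \<open>The truncated subtractions are harmless: their coefficients vanish when \<open>n = 0\<close> or \<open>k = 0\<close>.\<close>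

lemma D1_sym_monom:
  "D1 \<alpha> \<gamma> \<kappa> (sym_monom (n, k)) =
     const2 (jacobi_eigenvalue \<alpha> \<gamma> \<kappa> (n, k)) * sym_monom (n, k)
     + const2 (real n * (real n + 4 * real k + 2 * \<alpha> + 2 * \<kappa> + 2)) * sym_monom (n - 1, k)
     + const2 (real k * (real k + \<alpha>)) * sym_monom (n + 1, k - 1)"
proof -
  \<comment> \<open>Differentiating (xy)^k contributes the same term, k (x + y)^n (xy)^k, to both
    products. These cancel and leave a visible multiple of x - y.\<close>
  have num: "varX * dx (sym_monom (n, k)) - varY * dy (sym_monom (n, k)) =
      (varX - varY) * (of_nat n * sym_monom (n - 1, k))"
    by (simp add: dx_sym_monom dy_sym_monom algebra_simps)
  show ?thesis
  proof (rule eval2_eqI)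
    fix x y :: real
    define s t where "s = x + y" and "t = x * y"
    \<comment> \<open>These are s^n and t^k with their first two derivatives in s and t. Kept
      opaque, they enter through the Euler relations proved next, such as s s1 = n s0, so the long
      computation never sees a truncated exponent.\<close>
    define s0 s1 s2 t0 t1 t2 where "s0 = s ^ n" "s1 = real n * s ^ (n - 1)"
      "s2 = real n * (real (n - 1) * s ^ (n - 1 - 1))"
      "t0 = t ^ k" "t1 = real k * t ^ (k - 1)" "t2 = real k * (real (k - 1) * t ^ (k - 1 - 1))"
    note defs = this
    have s1: "s * s1 = n * s0" and t1: "t * t1 = k * t0"
      unfolding defs by (rule power_diff1_eq)+
    have s2: "s * s2 = n * s1 - s1"
      unfolding defs by (subst mult.left_commute, subst power_diff1_eq) (cases n; simp add: algebra_simps)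
    have t2: "t * t2 = k * t1 - t1"
      unfolding defs by (subst mult.left_commute, subst power_diff1_eq) (cases k; simp add: algebra_simps)
    let ?c = "2 * \<alpha> + \<gamma> + 2 * \<kappa> + 4"
    let ?m = "sym_monom (n, k)"
    have d: "eval2 (dx ?m) x y = s1 * t0 + y * s0 * t1"
      "eval2 (dy ?m) x y = s1 * t0 + x * s0 * t1"
      "eval2 (dx (dx ?m)) x y = s2 * t0 + 2 * y * s1 * t1 + y * y * s0 * t2"
      "eval2 (dx (dy ?m)) x y = s2 * t0 + x * s1 * t1 + y * s1 * t1 + x * y * s0 * t2 + s0 * t1"
      "eval2 (dy (dy ?m)) x y = s2 * t0 + 2 * x * s1 * t1 + x * x * s0 * t2"
      "eval2 (of_nat n) x y * eval2 (sym_monom (n - 1, k)) x y = s1 * t0"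
      unfolding defs s_def t_def
      by (simp_all add: dx_sym_monom dy_sym_monom d_simps eval2_simps eval2_sym_monom
          eval2_of_nat algebra_simps)
    have "eval2 (D1 \<alpha> \<gamma> \<kappa> (sym_monom (n, k))) x y =
      x * (1 - x) * (s2 * t0 + 2 * y * s1 * t1 + y * y * s0 * t2)
      - 2 * x * y * (s2 * t0 + x * s1 * t1 + y * s1 * t1 + x * y * s0 * t2 + s0 * t1)
      + y * (1 - y) * (s2 * t0 + 2 * x * s1 * t1 + x * x * s0 * t2)
      + (\<alpha> + 1 - ?c * x) * (s1 * t0 + y * s0 * t1)
      + (\<alpha> + 1 - ?c * y) * (s1 * t0 + x * s0 * t1) + (2 * \<kappa> + 1) * (s1 * t0)"
      unfolding D1_eq_quotient[OF num] by (simp only: eval2_simps d)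
    also have "\<dots> = (x * (1 - x) - 2 * x * y + y * (1 - y)) * (s2 * t0)
        + (2 * x * y * (1 - x) - 2 * x * y * (x + y) + 2 * x * y * (1 - y)) * (s1 * t1)
        + (x * y * y * (1 - x) - 2 * x * y * x * y + x * x * y * (1 - y)) * (s0 * t2)
        - 2 * (x * y) * (s0 * t1) + (2 * \<alpha> + 2 * \<kappa> + 3 - ?c * (x + y)) * (s1 * t0)
        + ((\<alpha> + 1) * (x + y) - 2 * ?c * (x * y)) * (s0 * t1)"
      by (simp only: ring_distribs) (simp add: mult_ac)
    also have "\<dots> = (s * (1 - s)) * (s2 * t0) + (4 * t * (1 - s)) * (s1 * t1)
        + (s * t - 4 * t * t) * (s0 * t2) - 2 * t * (s0 * t1)
        + (2 * \<alpha> + 2 * \<kappa> + 3 - ?c * s) * (s1 * t0)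
        + ((\<alpha> + 1) * s - 2 * ?c * t) * (s0 * t1)"
    proof -
      have "x * (1 - x) - 2 * x * y + y * (1 - y) = s * (1 - s)"
        "2 * x * y * (1 - x) - 2 * x * y * (x + y) + 2 * x * y * (1 - y) = 4 * t * (1 - s)"
        "x * y * y * (1 - x) - 2 * x * y * x * y + x * x * y * (1 - y) = s * t - 4 * t * t"
        unfolding s_def t_def by (simp_all add: algebra_simps)
      then show ?thesis
        by (simp only: s_def t_def)
    qed
    also have "\<dots> = (s * s2) * t0 * (1 - s) + 4 * s1 * (t * t1) * (1 - s)
        + s0 * (t * t2) * s - 4 * s0 * (t * (t * t2)) - 2 * s0 * (t * t1)
        + (2 * \<alpha> + 2 * \<kappa> + 3) * s1 * t0 - ?c * (s * s1) * t0 + (\<alpha> + 1) * s * s0 * t1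
        - 2 * ?c * s0 * (t * t1)"
      by (simp add: algebra_simps)
    \<comment> \<open>The second-order Euler relations remove \<open>s2\<close> and
      \<open>t2\<close>; the first-order ones, applied next, leave the products s0 t0, s1 t0 and s
      s0 t1, one for each monomial of the claim.\<close>
    also have "\<dots> = (real n - 1) * (s1 * t0 - (s * s1) * t0)
        + 4 * (s1 * (t * t1) - (s * s1) * (t * t1))
        + (real k - 1) * (s * s0 * t1) - 4 * (real k - 1) * (s0 * (t * t1)) - 2 * s0 * (t * t1)
        + (2 * \<alpha> + 2 * \<kappa> + 3) * s1 * t0 - ?c * (s * s1) * t0 + (\<alpha> + 1) * s * s0 * t1
        - 2 * ?c * s0 * (t * t1)"
      unfolding s2 t2 by (simp add: algebra_simps)
    also have "\<dots> = jacobi_eigenvalue \<alpha> \<gamma> \<kappa> (n, k) * (s0 * t0)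
        + (real n + 4 * real k + 2 * \<alpha> + 2 * \<kappa> + 2) * (s1 * t0) + (real k + \<alpha>) * (s * s0 * t1)"
      unfolding s1 t1 jacobi_eigenvalue_def prod.case by (simp add: algebra_simps)
    finally show "eval2 (D1 \<alpha> \<gamma> \<kappa> (sym_monom (n, k))) x y = eval2 (
     const2 (jacobi_eigenvalue \<alpha> \<gamma> \<kappa> (n, k)) * sym_monom (n, k)
     + const2 (real n * (real n + 4 * real k + 2 * \<alpha> + 2 * \<kappa> + 2)) * sym_monom (n - 1, k)
     + const2 (real k * (real k + \<alpha>)) * sym_monom (n + 1, k - 1)) x y"
      unfolding defs s_def t_def by (simp add: eval2_simps eval2_sym_monom algebra_simps)
  qed
qed

section \<open>Moments\<close>

lemma Beta_nonneg:
  fixes a b :: real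
  assumes "a > 0" "b > 0"
  shows "Beta a b \<ge> 0"
  by (rule has_integral_nonneg[OF has_integral_Beta_real[OF assms]]) simp

lemma nn_integral_Beta:
  fixes a b :: real
  assumes "a > 0" "b > 0"
  shows "(\<integral>\<^sup>+t. ennreal (t powr (a - 1) * (1 - t) powr (b - 1) * indicator {0..1} t) \<partial>lborel)
    = ennreal (Beta a b)"
proof -
  have "(\<integral>\<^sup>+t. ennreal (t powr (a - 1) * (1 - t) powr (b - 1)) * indicator {0..1} t \<partial>lborel)
    = ennreal (Beta a b)"
    by (rule nn_integral_has_integral_lebesgue'[OF _ has_integral_Beta_real[OF assms]]) auto
  then show ?thesis
    by (simp add: ennreal_mult' ennreal_indicator)
qed

text \<open>The substitution z = 4v(1 - v) is increasing on [0, 1/2], with 1 - z = (1 - 2v)^2 and dz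
  = 4(1 - 2v) dv. Hence the exponent 2b + 1, and the power of 4 comes from z^a together with
  dz.\<close>

lemma nn_integral_symmetric_Beta:
  fixes a b :: real
  assumes "a > - 1" "b > - 1"
  shows "(\<integral>\<^sup>+v. ennreal ((v * (1 - v)) powr a * (1 - 2 * v) powr (2 * b + 1) * indicator {0..1/2} v)
      \<partial>lborel) = ennreal (Beta (a + 1) (b + 1) / 4 powr (a + 1))"
proof -
  let ?f = "\<lambda>z::real. z powr a * (1 - z) powr b"
  let ?h = "\<lambda>v::real. (v * (1 - v)) powr a * (1 - 2 * v) powr (2 * b + 1) * indicator {0..1/2} v"
  define g where "g v = 4 * v * (1 - v)" for v :: real
  define g' where "g' v = 4 - 8 * v" for v :: real
  have eq: "?f (g v) * g' v * indicator {0..1/2} v = 4 powr (a + 1) * ?h v" for v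
  proof (cases "v \<in> {0..<1/2}")
    case True
    then have "1 - 2 * v > 0" "v * (1 - v) \<ge> 0" by auto
    moreover have "(1 - g v) powr b = (1 - 2 * v) powr (2 * b)"
    proof -
      have "1 - g v = (1 - 2 * v) powr 2"
        using True by (simp add: g_def power2_eq_square algebra_simps)
      then show ?thesis
        by (simp only: powr_powr)
    qed
    moreover have "g v powr a = 4 powr a * (v * (1 - v)) powr a"
      using powr_mult[of 4 "v * (1 - v)" a] True by (simp add: g_def mult.assoc)
    ultimately show ?thesis
      using True by (simp add: powr_powr powr_add g'_def mult_ac)
  next
    case False
    \<comment> \<open>At v = 1/2 the left side vanishes through \<open>g'\<close> and the right side
      because \<open>powr\<close> is 0 at base 0.\<close>
    show ?thesis
    proof (cases "v = 1/2")
      case True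
      show ?thesis
        unfolding True g_def g'_def by simp
    qed (use False in auto)
  qed
  have "ennreal (Beta (a + 1) (b + 1)) = (\<integral>\<^sup>+z. ennreal (?f z * indicator {g 0..g (1/2)} z) \<partial>lborel)"
    using nn_integral_Beta[of "a + 1" "b + 1"] assms by (simp add: g_def)
  also have "\<dots> = (\<integral>\<^sup>+v. ennreal (?f (g v) * g' v * indicator {0..1/2} v) \<partial>lborel)"
  proof (rule nn_integral_substitution)
    show "(g has_real_derivative g' v) (at v)" for v
      unfolding g_def g'_def by (auto intro!: derivative_eq_intros simp: algebra_simps)
    show "continuous_on {0..1/2} g'"
      unfolding g'_def by (intro continuous_intros)
  qed (auto simp: g'_def set_borel_measurable_def)
  also have "\<dots> = (\<integral>\<^sup>+v. ennreal (4 powr (a + 1)) * ennreal (?h v) \<partial>lborel)"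
    unfolding eq by (simp add: ennreal_mult')
  also have "\<dots> = ennreal (4 powr (a + 1)) * (\<integral>\<^sup>+v. ennreal (?h v) \<partial>lborel)"
    by (rule nn_integral_cmult) measurable
  finally have "ennreal (1 / 4 powr (a + 1)) * ennreal (Beta (a + 1) (b + 1)) =
      ennreal (1 / 4 powr (a + 1)) * ennreal (4 powr (a + 1)) * (\<integral>\<^sup>+v. ennreal (?h v) \<partial>lborel)"
    by (simp add: mult.assoc)
  then show ?thesis
    by (simp flip: ennreal_mult')
qed

lemma half_triangle_borel [measurable]: "half_triangle \<in> sets borel"
proof -
  have "half_triangle = {z. 0 \<le> fst z} \<inter> {z. 0 \<le> snd z} \<inter> {z. fst z + snd z \<le> 1} \<inter> {z. snd z < fst z}"
    by (auto simp: half_triangle_def T2_def)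
  also have "\<dots> \<in> sets borel"
    by (intro sets.Int borel_closed borel_open closed_Collect_le open_Collect_less continuous_intros)
  finally show ?thesis .
qed

lemma weight_measurable [measurable]: "(\<lambda>z. weight \<alpha> \<gamma> \<kappa> (fst z) (snd z)) \<in> borel_measurable borel"
  unfolding weight_def borel_prod[symmetric] by measurable

lemma weight_nonneg: "weight \<alpha> \<gamma> \<kappa> x y \<ge> 0"
  by (simp add: weight_def)

text \<open>In the first argument, 2\<kappa> + 3 collects 2\<kappa> + 1 from |x - y|, 1 from the
  Jacobian and 1 from the convention t^(a-1) in the Beta integral. The power of 4 comes from passing
  from v = y / (x + y) to 4v(1 - v).\<close>

definition moment :: "real \<Rightarrow> real \<Rightarrow> real \<Rightarrow> nat \<times> nat \<Rightarrow> real" where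
  "moment \<alpha> \<gamma> \<kappa> = (\<lambda>(n, k). Beta (real (n + 2 * k) + 2 * \<alpha> + 2 * \<kappa> + 3) (\<gamma> + 1)
     * (Beta (real k + \<alpha> + 1) (\<kappa> + 1) / 4 powr (real k + \<alpha> + 1)))"

text \<open>The change of variables x = s(1 - v), y = s v with Jacobian s is split by Tonelli into
  two affine substitutions on the line: x = s - y for fixed y, then y = s v for fixed s. The
  condition y < x becomes v < 1/2.\<close>

lemma nn_integral_half_triangle_coordinates:
  fixes G :: "real \<times> real \<Rightarrow> ennreal"
  assumes G [measurable]: "G \<in> borel_measurable borel"
  shows "(\<integral>\<^sup>+z. G z * indicator half_triangle z \<partial>lborel) =
    (\<integral>\<^sup>+s. (\<integral>\<^sup>+v. G (s * (1 - v), s * v) * ennreal s * indicator {0<..1} s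
       * indicator {0..<1/2} v \<partial>lborel) \<partial>lborel)"
proof -
  define H where "H z = G z * indicator half_triangle z" for z
  have H_borel: "H \<in> borel_measurable borel"
    unfolding H_def by measurable
  have H [measurable]: "H \<in> borel_measurable (borel \<Otimes>\<^sub>M borel)"
    using H_borel by (simp add: borel_prod)
  have "integral\<^sup>N lborel H = (\<integral>\<^sup>+y. (\<integral>\<^sup>+x. H (x, y) \<partial>lborel) \<partial>lborel)"
    using lborel_pair.nn_integral_snd[of H] H_borel by (simp add: lborel_prod)
  also have "\<dots> = (\<integral>\<^sup>+y. (\<integral>\<^sup>+s. H (s - y, y) \<partial>lborel) \<partial>lborel)"
  proof (rule nn_integral_cong)
    fix y :: real
    show "(\<integral>\<^sup>+x. H (x, y) \<partial>lborel) = (\<integral>\<^sup>+s. H (s - y, y) \<partial>lborel)"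
      by (subst nn_integral_real_affine[of _ 1 "- y"]) simp_all
  qed
  also have "\<dots> = (\<integral>\<^sup>+s. (\<integral>\<^sup>+y. H (s - y, y) \<partial>lborel) \<partial>lborel)"
    by (rule lborel_pair.Fubini') measurable
  also have "\<dots> = (\<integral>\<^sup>+s. (\<integral>\<^sup>+v. G (s * (1 - v), s * v) * ennreal s * indicator {0<..1} s
       * indicator {0..<1/2} v \<partial>lborel) \<partial>lborel)"
  proof (rule nn_integral_cong)
    fix s :: real
    show "(\<integral>\<^sup>+y. H (s - y, y) \<partial>lborel) = (\<integral>\<^sup>+v. G (s * (1 - v), s * v) * ennreal s
        * indicator {0<..1} s * indicator {0..<1/2} v \<partial>lborel)"
    proof (cases "s > 0")
      case True
      have "(\<integral>\<^sup>+y. H (s - y, y) \<partial>lborel) = ennreal s * (\<integral>\<^sup>+v. H (s - s * v, s * v) \<partial>lborel)"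
        using True by (subst nn_integral_real_affine[of _ s 0]) simp_all
      also have "\<dots> = (\<integral>\<^sup>+v. ennreal s * H (s - s * v, s * v) \<partial>lborel)"
        by (rule nn_integral_cmult[symmetric]) measurable
      also have "\<dots> = (\<integral>\<^sup>+v. G (s * (1 - v), s * v) * ennreal s
        * indicator {0<..1} s * indicator {0..<1/2} v \<partial>lborel)"
      proof (rule nn_integral_cong)
        fix v :: real
        have "s * v < s - s * v \<longleftrightarrow> s * (2 * v) < s * 1"
          by (simp add: algebra_simps)
        also have "\<dots> \<longleftrightarrow> v < 1/2"
          using True by (subst mult_less_cancel_left_pos) auto
        finally have "(s - s * v, s * v) \<in> half_triangle \<longleftrightarrow> s \<in> {0<..1} \<and> v \<in> {0..<1/2}"
          using True by (auto simp: half_triangle_def T2_def zero_le_mult_iff)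
        then show "ennreal s * H (s - s * v, s * v) = G (s * (1 - v), s * v) * ennreal s
            * indicator {0<..1} s * indicator {0..<1/2} v"
          by (auto simp: H_def indicator_def right_diff_distrib mult.commute)
      qed
      finally show ?thesis .
    next
      case False
      \<comment> \<open>On the half triangle 0 <= y < s - y, which forces s > 0.\<close>
      then have "H (s - y, y) = 0" for y
        by (auto simp: H_def half_triangle_def T2_def indicator_def)
      then show ?thesis
        using False by simp
    qed
  qed
  finally show ?thesis
    unfolding H_def .
qed

text \<open>Here xy = s^2 v(1 - v), x - y = s(1 - 2v) and 1 - x - y = 1 - s, so the variables
  separate; the trailing factor \<open>s\<close> is the Jacobian.\<close>

lemma weight_coordinates:
  assumes "0 < s" "s \<le> 1" "0 \<le> v" "v < 1/2"
  shows "eval2 (sym_monom (n, k)) (s * (1 - v)) (s * v) * weight \<alpha> \<gamma> \<kappa> (s * (1 - v)) (s * v) * s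
    = s powr (real (n + 2 * k) + 2 * \<alpha> + 2 * \<kappa> + 2) * (1 - s) powr \<gamma>
      * ((v * (1 - v)) powr (k + \<alpha>) * (1 - 2 * v) powr (2 * \<kappa> + 1))"
\<comment> \<open>At v = 0 both sides vanish, whatever the exponents, because \<open>powr\<close> is
  0 at base 0. Otherwise v(1 - v) is positive and natural powers can be written with
  \<open>powr\<close>.\<close>
proof (cases "v = 0")
  case True
  then show ?thesis by (simp add: weight_def)
next
  case False
  define q where "q = v * (1 - v)"
  have q: "q > 0"
    using False assms by (simp add: q_def)
  have sum: "s * (1 - v) + s * v = s" and dif: "s * (1 - v) - s * v = s * (1 - 2 * v)"
    and prod: "s * (1 - v) * (s * v) = s powr 2 * q" and last: "1 - s * (1 - v) - s * v = 1 - s"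
    using assms by (simp_all add: q_def algebra_simps power2_eq_square)
  have "eval2 (sym_monom (n, k)) (s * (1 - v)) (s * v) * weight \<alpha> \<gamma> \<kappa> (s * (1 - v)) (s * v) * s
     = s powr n * (s powr 2 * q) powr k * ((s powr 2 * q) powr \<alpha> * (1 - s) powr \<gamma>
         * (s * (1 - 2 * v)) powr (2 * \<kappa> + 1)) * s powr 1"
    using assms q unfolding eval2_sym_monom weight_def sum prod last dif
    by (simp add: powr_realpow)
  also have "\<dots> = (s powr n * s powr (2 * real k) * s powr (2 * \<alpha>) * s powr (2 * \<kappa> + 1) * s powr 1)
      * (1 - s) powr \<gamma> * ((q powr k * q powr \<alpha>) * (1 - 2 * v) powr (2 * \<kappa> + 1))"
  proof -
    have "(s powr 2 * q) powr a = s powr (2 * a) * q powr a" for a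
      using assms q by (subst powr_mult) (simp_all add: powr_powr del: powr_numeral)
    moreover have "(s * (1 - 2 * v)) powr (2 * \<kappa> + 1)
        = s powr (2 * \<kappa> + 1) * (1 - 2 * v) powr (2 * \<kappa> + 1)"
      using assms by (simp add: powr_mult)
    ultimately show ?thesis
      by (simp only: mult_ac)
  qed
  also have "\<dots> = s powr (real n + 2 * real k + 2 * \<alpha> + (2 * \<kappa> + 1) + 1)
      * (1 - s) powr \<gamma> * (q powr (k + \<alpha>) * (1 - 2 * v) powr (2 * \<kappa> + 1))"
    by (simp only: powr_add mult_ac)
  finally show ?thesis
    by (simp add: q_def algebra_simps)
qed

lemma nn_integral_sym_monom_weight:
  assumes "\<alpha> > -1" "\<gamma> > -1" "\<kappa> > -1" "\<alpha> + \<kappa> > -3/2"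
  shows "(\<integral>\<^sup>+z. ennreal (eval2 (sym_monom i) (fst z) (snd z) * weight \<alpha> \<gamma> \<kappa> (fst z) (snd z))
      * indicator half_triangle z \<partial>lborel) = ennreal (moment \<alpha> \<gamma> \<kappa> i)"
proof -
  obtain n k where i: "i = (n, k)" by fastforce
  define G where "G z = ennreal (eval2 (sym_monom i) (fst z) (snd z) * weight \<alpha> \<gamma> \<kappa> (fst z) (snd z))"
    for z :: "real \<times> real"
  define S where "S s = s powr (real (n + 2 * k) + 2 * \<alpha> + 2 * \<kappa> + 2) * (1 - s) powr \<gamma> * indicator {0..1} s"
    for s :: real
  define V where "V v = (v * (1 - v)) powr (k + \<alpha>) * (1 - 2 * v) powr (2 * \<kappa> + 1) * indicator {0..1/2} v"
    for v :: real
  have [measurable]: "S \<in> borel_measurable borel" "V \<in> borel_measurable borel"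
    unfolding S_def V_def by measurable
  have nonneg: "S s \<ge> 0" "V v \<ge> 0" for s v
    by (simp_all add: S_def V_def)
  have "(\<lambda>z::real\<times>real. eval2 (sym_monom i) (fst z) (snd z) * weight \<alpha> \<gamma> \<kappa> (fst z) (snd z))
      \<in> borel_measurable (borel \<Otimes>\<^sub>M borel)"
    unfolding i eval2_sym_monom weight_def by measurable
  then have G [measurable]: "G \<in> borel_measurable borel"
    unfolding G_def by (simp add: borel_prod)
  have "(\<integral>\<^sup>+z. G z * indicator half_triangle z \<partial>lborel)
      = (\<integral>\<^sup>+s. (\<integral>\<^sup>+v. ennreal (S s) * ennreal (V v) \<partial>lborel) \<partial>lborel)"
    unfolding nn_integral_half_triangle_coordinates[OF G]
  proof (intro nn_integral_cong)
    fix s v :: real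
    show "G (s * (1 - v), s * v) * ennreal s * indicator {0<..1} s * indicator {0..<1/2} v
        = ennreal (S s) * ennreal (V v)"
    proof (cases "s \<in> {0<..1} \<and> v \<in> {0..<1/2}")
      case True
      then have "G (s * (1 - v), s * v) * ennreal s
          = ennreal (eval2 (sym_monom (n, k)) (s * (1 - v)) (s * v) * weight \<alpha> \<gamma> \<kappa> (s * (1 - v)) (s * v) * s)"
        by (simp add: G_def i ennreal_mult'')
      also have "\<dots> = ennreal (S s * V v)"
        using True by (subst weight_coordinates) (auto simp: S_def V_def)
      finally show ?thesis
        using True nonneg by (simp add: ennreal_mult)
    next
      case False
      \<comment> \<open>The region gave half-open intervals, the Beta integrals closed ones. The
        extra endpoints s = 0 and v = 1/2 contribute 0, since a \<open>powr\<close> factor there has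
        base 0.\<close>
      moreover from this have "S s = 0 \<or> V v = 0"
        by (cases "s = 0"; cases "v = 1/2") (auto simp: S_def V_def indicator_def)
      ultimately show ?thesis
        by auto
    qed
  qed
  also have "\<dots> = (\<integral>\<^sup>+s. ennreal (S s) \<partial>lborel) * (\<integral>\<^sup>+v. ennreal (V v) \<partial>lborel)"
    by (simp add: nn_integral_cmult nn_integral_multc)
  also have "(\<integral>\<^sup>+s. ennreal (S s) \<partial>lborel)
      = ennreal (Beta (real (n + 2 * k) + 2 * \<alpha> + 2 * \<kappa> + 3) (\<gamma> + 1))"
    using nn_integral_Beta[of "real (n + 2 * k) + 2 * \<alpha> + 2 * \<kappa> + 3" "\<gamma> + 1"] assms
    by (simp add: S_def add_ac)
  also have "(\<integral>\<^sup>+v. ennreal (V v) \<partial>lborel) =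
      ennreal (Beta (real k + \<alpha> + 1) (\<kappa> + 1) / 4 powr (real k + \<alpha> + 1))"
    unfolding V_def using assms by (intro nn_integral_symmetric_Beta) auto
  also have "ennreal (Beta (real (n + 2 * k) + 2 * \<alpha> + 2 * \<kappa> + 3) (\<gamma> + 1))
      * ennreal (Beta (real k + \<alpha> + 1) (\<kappa> + 1) / 4 powr (real k + \<alpha> + 1)) = ennreal (moment \<alpha> \<gamma> \<kappa> i)"
    unfolding i moment_def prod.case
    by (rule ennreal_mult'[symmetric]) (use assms in \<open>auto intro!: Beta_nonneg\<close>)
  finally show ?thesis
    unfolding G_def .
qed

section \<open>Spans of symmetric monomials\<close>

text \<open>Provides the library's \<open>span\<close>, in which having lower degree becomes
  membership in the span of the lower monomials.\<close>

interpretation bipoly: vector_space "\<lambda>c p. const2 c * p"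
  by unfold_locales (auto simp: eval2_simps algebra_simps intro!: eval2_eqI)

lemma sym_expansion_iff:
  assumes "finite J" "{i. c i \<noteq> 0} \<subseteq> J"
  shows "sym_expansion p c \<longleftrightarrow> p = (\<Sum>i\<in>J. const2 (c i) * sym_monom i)"
proof -
  have "(\<Sum>i | c i \<noteq> 0. const2 (c i) * sym_monom i) = (\<Sum>i\<in>J. const2 (c i) * sym_monom i)"
    using assms by (intro sum.mono_neutral_left) auto
  moreover have "finite {i. c i \<noteq> 0}"
    using assms finite_subset by blast
  ultimately show ?thesis
    by (simp add: sym_expansion_def)
qed

lemma span_sym_monom_iff:
  "p \<in> bipoly.span (sym_monom ` I) \<longleftrightarrow> (\<exists>c. sym_expansion p c \<and> (\<forall>i. c i \<noteq> 0 \<longrightarrow> i \<in> I))"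
proof
  assume "p \<in> bipoly.span (sym_monom ` I)"
  then show "\<exists>c. sym_expansion p c \<and> (\<forall>i. c i \<noteq> 0 \<longrightarrow> i \<in> I)"
  proof (induction rule: bipoly.span_induct_alt)
    case base
    show ?case
      by (intro exI[of _ "\<lambda>_. 0"]) (simp add: sym_expansion_def)
  next
    case (step a m q)
    then obtain i c where i: "i \<in> I" "m = sym_monom i"
      and c: "sym_expansion q c" "\<And>i. c i \<noteq> 0 \<Longrightarrow> i \<in> I"
      by auto
    \<comment> \<open>One finite set supporting both the old and the updated coefficient function,
      even if the updated coefficient cancels to 0.\<close>
    define J where "J = insert i {i. c i \<noteq> 0}"
    have J: "finite J" "{i. c i \<noteq> 0} \<subseteq> J" "i \<in> J"
      using c(1) by (auto simp: J_def sym_expansion_def)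
    let ?c = "c(i := a + c i)"
    have "const2 a * m + q = const2 a * sym_monom i + (\<Sum>j\<in>J. const2 (c j) * sym_monom j)"
      using c(1) sym_expansion_iff[OF J(1,2)] i(2) by simp
    also have "\<dots> = (\<Sum>j\<in>J. const2 (?c j) * sym_monom j)"
      using J by (simp add: sum.remove[of J i] bipoly.scale_left_distrib)
    finally have "sym_expansion (const2 a * m + q) ?c"
      using J by (subst sym_expansion_iff[of J]) (auto split: if_splits)
    moreover have "\<forall>j. ?c j \<noteq> 0 \<longrightarrow> j \<in> I"
      using c(2) i(1) by auto
    ultimately show ?case
      by blast
  qed
next
  assume "\<exists>c. sym_expansion p c \<and> (\<forall>i. c i \<noteq> 0 \<longrightarrow> i \<in> I)"
  then obtain c where c: "p = (\<Sum>i | c i \<noteq> 0. const2 (c i) * sym_monom i)" "\<And>i. c i \<noteq> 0 \<Longrightarrow> i \<in> I"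
    by (auto simp: sym_expansion_def)
  show "p \<in> bipoly.span (sym_monom ` I)"
    unfolding c(1)
    by (intro bipoly.span_sum bipoly.span_scale, rule bipoly.span_base) (use c(2) in auto)
qed

lemma symmetric2_add: "symmetric2 p \<Longrightarrow> symmetric2 q \<Longrightarrow> symmetric2 (p + q)"
  and symmetric2_scale: "symmetric2 p \<Longrightarrow> symmetric2 (const2 c * p)"
  by (simp_all add: symmetric2_def eval2_simps)

text \<open>Symmetry of the partial sum \<open>q\<close> is carried along the induction because
  \<open>D1_add\<close> and \<open>D1_scale\<close> ask for symmetric arguments.\<close>

lemma span_sym_monom_induct [consumes 1, case_names zero step]:
  assumes "p \<in> bipoly.span (sym_monom ` I)" and "P 0"
    and "\<And>c i q. i \<in> I \<Longrightarrow> symmetric2 q \<Longrightarrow> P q \<Longrightarrow> P (const2 c * sym_monom i + q)"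
  shows "P p"
proof -
  have "symmetric2 p \<and> P p"
    using assms(1)
  proof (induction rule: bipoly.span_induct_alt)
    case base
    show ?case
      using assms(2) by (simp add: symmetric2_def eval2_0)
  next
    case (step c m q)
    then show ?case
      using assms(3) symmetric2_sym_monom by (auto intro!: symmetric2_add symmetric2_scale)
  qed
  then show ?thesis by simp
qed

lemma span_sym_monom_symmetric2: "p \<in> bipoly.span (sym_monom ` I) \<Longrightarrow> symmetric2 p"
proof (induction rule: span_sym_monom_induct)
  case zero
  show ?case by (simp add: symmetric2_def eval2_0)
qed (simp add: symmetric2_add symmetric2_scale symmetric2_sym_monom)

lemma has_sym_degree_imp_span: "has_sym_degree q d \<Longrightarrow> q \<in> bipoly.span (sym_monom ` {i. i = d \<or> i \<prec> d})"
  unfolding has_sym_degree_def span_sym_monom_iff by blast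

lemma has_sym_degree_sym_monom: "has_sym_degree (sym_monom d) d"
proof -
  let ?c = "\<lambda>i. if i = d then 1 else 0 :: real"
  have "sym_expansion (sym_monom d) ?c"
    by (subst sym_expansion_iff[of "{d}"]) (auto split: if_splits)
  moreover have "?c d \<noteq> 0" "\<forall>i. ?c i \<noteq> 0 \<longrightarrow> i = d \<or> i \<prec> d"
    by (simp_all del: split_paired_All)
  ultimately show ?thesis
    unfolding has_sym_degree_def by blast
qed

lemma sdeg_less_trans: "i \<prec> j \<Longrightarrow> j \<prec> d \<Longrightarrow> i \<prec> d"
  by (auto simp: sdeg_less_def split: prod.splits)

lemma finite_sdeg_less: "finite {i. i \<prec> d}"
proof -
  obtain n k where d: "d = (n, k)" by fastforce
  have "{i. i \<prec> d} \<subseteq> {..n + 2 * k} \<times> {..n + 2 * k}"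
    by (auto simp: d sdeg_less_def)
  then show ?thesis
    by (rule finite_subset) simp
qed

text \<open>Both (n - 1, k) and (n + 1, k - 1) have weighted degree n + 2k - 1. Where a subtraction
  would truncate, the coefficient n or k is 0.\<close>

lemma D1_sym_monom_minus_in_span:
  "D1 \<alpha> \<gamma> \<kappa> (sym_monom d) - const2 (jacobi_eigenvalue \<alpha> \<gamma> \<kappa> d) * sym_monom d
    \<in> bipoly.span (sym_monom ` {i. i \<prec> d})"
proof -
  obtain n k where d: "d = (n, k)" by fastforce
  have "const2 (real n * c) * sym_monom (n - 1, k) \<in> bipoly.span (sym_monom ` {i. i \<prec> d})" for c
  proof (cases "n = 0")
    case False
    then have "(n - 1, k) \<prec> d"
      by (auto simp: d sdeg_less_def)
    then show ?thesis
      by (intro bipoly.span_scale bipoly.span_base imageI CollectI)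
  qed (simp add: bipoly.span_zero)
  moreover have "const2 (real k * c) * sym_monom (n + 1, k - 1) \<in> bipoly.span (sym_monom ` {i. i \<prec> d})" for c
  proof (cases "k = 0")
    case False
    then have "(n + 1, k - 1) \<prec> d"
      by (auto simp: d sdeg_less_def)
    then show ?thesis
      by (intro bipoly.span_scale bipoly.span_base imageI CollectI)
  qed (simp add: bipoly.span_zero)
  ultimately show ?thesis
    unfolding d D1_sym_monom by (simp add: add.assoc bipoly.span_add)
qed

lemma D1_zero: "D1 \<alpha> \<gamma> \<kappa> 0 = 0"
  using D1_scale[of 0 \<alpha> \<gamma> \<kappa> 0] by (simp add: symmetric2_def eval2_0)

lemma D1_minus_in_span:
  assumes "p \<in> bipoly.span (sym_monom ` {i. i \<prec> d})"
  shows "D1 \<alpha> \<gamma> \<kappa> p \<in> bipoly.span (sym_monom ` {i. i \<prec> d})"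
  using assms
proof (induction rule: span_sym_monom_induct)
  case zero
  show ?case by (simp add: D1_zero bipoly.span_zero)
next
  case (step c j q)
  let ?m = "sym_monom j"
  have "j \<prec> d"
    using step.hyps by simp
  then have "bipoly.span (sym_monom ` {i. i \<prec> j}) \<subseteq> bipoly.span (sym_monom ` {i. i \<prec> d})"
    using sdeg_less_trans by (intro bipoly.span_mono image_mono) blast
  then have "D1 \<alpha> \<gamma> \<kappa> ?m - const2 (jacobi_eigenvalue \<alpha> \<gamma> \<kappa> j) * ?m
      \<in> bipoly.span (sym_monom ` {i. i \<prec> d})"
    using D1_sym_monom_minus_in_span by blast
  moreover have "const2 (jacobi_eigenvalue \<alpha> \<gamma> \<kappa> j) * ?m \<in> bipoly.span (sym_monom ` {i. i \<prec> d})"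
    using step.hyps by (intro bipoly.span_scale bipoly.span_base imageI)
  ultimately have "D1 \<alpha> \<gamma> \<kappa> ?m \<in> bipoly.span (sym_monom ` {i. i \<prec> d})"
    using bipoly.span_add[of "D1 \<alpha> \<gamma> \<kappa> ?m - const2 (jacobi_eigenvalue \<alpha> \<gamma> \<kappa> j) * ?m"] by fastforce
  then show ?case
    using step by (simp add: D1_add D1_scale symmetric2_sym_monom symmetric2_scale
      bipoly.span_add bipoly.span_scale)
qed

section \<open>The inner product and the orthogonal basis\<close>

lemma poly_bounded_unit_interval:
  "\<exists>C. \<forall>y\<in>{0..1}. \<bar>poly p y\<bar> \<le> C" for p :: "real poly"
proof -
  have "compact (poly p ` {0..1})"
    by (intro compact_continuous_image continuous_intros) auto
  then show ?thesis
    by (auto simp: bounded_iff dest!: compact_imp_bounded)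
qed

lemma eval2_bounded_unit_square:
  "\<exists>C. \<forall>x\<in>{0..1}. \<forall>y\<in>{0..1}. \<bar>eval2 p x y\<bar> \<le> C"
proof (induction p)
  case 0
  show ?case by (auto simp: eval2_0)
next
  case (pCons a p)
  then obtain C where C: "\<forall>x\<in>{0..1}. \<forall>y\<in>{0..1}. \<bar>eval2 p x y\<bar> \<le> C" by blast
  obtain B where B: "\<forall>y\<in>{0..1}. \<bar>poly a y\<bar> \<le> B"
    using poly_bounded_unit_interval by blast
  have "\<bar>eval2 (pCons a p) x y\<bar> \<le> B + C" if "x \<in> {0..1}" "y \<in> {0..1}" for x y
  proof -
    have "\<bar>x * eval2 p x y\<bar> \<le> 1 * C"
      unfolding abs_mult using that C by (intro mult_mono) auto
    then show ?thesis
      using B that unfolding eval2_pCons by fastforce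
  qed
  then show ?case by blast
qed

lemma continuous_on_eval2: "continuous_on UNIV (\<lambda>z. eval2 p (fst z) (snd z))"
  unfolding eval2_def
proof (induction p)
  case (pCons a p)
  then show ?case
    by (simp, intro continuous_intros)
qed simp

text \<open>With the indicator inside the integrand, the inner product is an ordinary integral that
  depends on \<open>p\<close> and \<open>q\<close> only through their product.\<close>

definition weighted :: "real \<Rightarrow> real \<Rightarrow> real \<Rightarrow> bipoly \<Rightarrow> real \<times> real \<Rightarrow> real" where
  "weighted \<alpha> \<gamma> \<kappa> p z =
     indicator half_triangle z * (eval2 p (fst z) (snd z) * weight \<alpha> \<gamma> \<kappa> (fst z) (snd z))"

lemma w_inner_eq_integral: "w_inner \<alpha> \<gamma> \<kappa> p q = integral\<^sup>L lborel (weighted \<alpha> \<gamma> \<kappa> (p * q))"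
  unfolding w_inner_def set_lebesgue_integral_def weighted_def
  by (simp add: case_prod_beta eval2_mult)

lemma weighted_measurable [measurable]: "weighted \<alpha> \<gamma> \<kappa> p \<in> borel_measurable borel"
proof -
  have "(\<lambda>z. eval2 p (fst z) (snd z)) \<in> borel_measurable borel"
    by (rule borel_measurable_continuous_onI[OF continuous_on_eval2])
  then show ?thesis
    unfolding weighted_def[abs_def] by measurable
qed

section \<open>Integrability, bilinearity and definiteness of the inner product\<close>

locale jacobi_triangle =
  fixes \<alpha> \<gamma> \<kappa> :: real
  assumes params: "\<alpha> > -1" "\<gamma> > -1" "\<kappa> > -1" "\<alpha> + \<kappa> > -3/2"
begin

lemma moment_nonneg: "moment \<alpha> \<gamma> \<kappa> i \<ge> 0"
  using params by (cases i) (auto simp: moment_def intro!: mult_nonneg_nonneg divide_nonneg_nonneg Beta_nonneg)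

lemma has_bochner_integral_sym_monom:
  "has_bochner_integral lborel (weighted \<alpha> \<gamma> \<kappa> (sym_monom i)) (moment \<alpha> \<gamma> \<kappa> i)"
proof (rule has_bochner_integral_nn_integral)
  have "0 \<le> eval2 (sym_monom i) x y" if "(x, y) \<in> half_triangle" for x y
    using that by (cases i) (auto simp: eval2_sym_monom half_triangle_def T2_def)
  then show "AE z in lborel. 0 \<le> weighted \<alpha> \<gamma> \<kappa> (sym_monom i) z"
    by (auto simp: weighted_def weight_nonneg indicator_def)
  show "(\<integral>\<^sup>+z. ennreal (weighted \<alpha> \<gamma> \<kappa> (sym_monom i) z) \<partial>lborel) = ennreal (moment \<alpha> \<gamma> \<kappa> i)"
    unfolding nn_integral_sym_monom_weight[OF params, symmetric]
    by (intro nn_integral_cong) (simp add: weighted_def indicator_def)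
qed (simp_all add: moment_nonneg)

text \<open>A polynomial is bounded on the unit square, so the integrand is dominated by a multiple
  of the weight, whose integral is the moment of index (0, 0).\<close>

lemma integrable_weighted: "integrable lborel (weighted \<alpha> \<gamma> \<kappa> p)"
proof -
  obtain C where C: "\<forall>x\<in>{0..1}. \<forall>y\<in>{0..1}. \<bar>eval2 p x y\<bar> \<le> C"
    using eval2_bounded_unit_square by blast
  have one: "sym_monom (0, 0) = 1"
    by (simp add: sym_monom_def)
  have bound: "\<bar>weighted \<alpha> \<gamma> \<kappa> p z\<bar> \<le> \<bar>C * weighted \<alpha> \<gamma> \<kappa> 1 z\<bar>" for z
  proof (cases "z \<in> half_triangle")
    case True
    then have "fst z \<in> {0..1}" "snd z \<in> {0..1}"
      by (auto simp: half_triangle_def T2_def)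
    then have "\<bar>eval2 p (fst z) (snd z)\<bar> \<le> \<bar>C\<bar>"
      using C by (meson abs_ge_self order_trans)
    then show ?thesis
      using True by (simp add: weighted_def eval2_1 abs_mult mult_right_mono)
  qed (simp add: weighted_def)
  show ?thesis
  proof (rule Bochner_Integration.integrable_bound)
    show "integrable lborel (\<lambda>z. C * weighted \<alpha> \<gamma> \<kappa> 1 z)"
      using has_bochner_integral_sym_monom[of "(0, 0)"] unfolding one
      by (simp add: has_bochner_integral_iff)
  qed (use bound in auto)
qed

abbreviation inner :: "bipoly \<Rightarrow> bipoly \<Rightarrow> real" where "inner \<equiv> w_inner \<alpha> \<gamma> \<kappa>"

lemma inner_commute: "inner p q = inner q p"
  by (simp add: w_inner_eq_integral mult.commute)

lemma inner_add_left: "inner (p + p') q = inner p q + inner p' q"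
proof -
  have "weighted \<alpha> \<gamma> \<kappa> ((p + p') * q) = (\<lambda>z. weighted \<alpha> \<gamma> \<kappa> (p * q) z + weighted \<alpha> \<gamma> \<kappa> (p' * q) z)"
    by (simp add: weighted_def eval2_simps algebra_simps fun_eq_iff)
  then show ?thesis
    by (simp add: w_inner_eq_integral integrable_weighted)
qed

lemma inner_scale_left: "inner (const2 c * p) q = c * inner p q"
proof -
  have "weighted \<alpha> \<gamma> \<kappa> (const2 c * p * q) = (\<lambda>z. c * weighted \<alpha> \<gamma> \<kappa> (p * q) z)"
    by (simp add: weighted_def eval2_simps algebra_simps fun_eq_iff)
  then show ?thesis
    by (simp add: w_inner_eq_integral)
qed

lemma inner_add_right: "inner q (p + p') = inner q p + inner q p'"
  and inner_scale_right: "inner q (const2 c * p) = c * inner q p"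
  by (simp_all add: inner_commute[of q] inner_add_left inner_scale_left)

lemma inner_zero_left: "inner 0 q = 0"
  using inner_add_left[of 0 0 q] by simp

lemma inner_zero_right: "inner q 0 = 0"
  by (simp add: inner_commute[of q] inner_zero_left)

lemma inner_diff_left: "inner (p - p') q = inner p q - inner p' q"
  using inner_add_left[of "p - p'" p' q] by simp

lemma inner_span_eq_0:
  assumes "q \<in> bipoly.span S" and "\<And>s. s \<in> S \<Longrightarrow> inner p s = 0"
  shows "inner p q = 0"
  using assms(1)
proof (induction rule: bipoly.span_induct_alt)
  case base
  show ?case by (rule inner_zero_right)
qed (simp add: inner_add_right inner_scale_right assms(2))

lemma inner_sym_monom: "inner (sym_monom (n, k)) (sym_monom (m, l)) = moment \<alpha> \<gamma> \<kappa> (n + m, k + l)"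
proof -
  have "sym_monom (n, k) * sym_monom (m, l) = sym_monom (n + m, k + l)"
    by (simp add: sym_monom_def power_add mult_ac)
  then show ?thesis
    using has_bochner_integral_sym_monom[of "(n + m, k + l)"]
    by (simp add: w_inner_eq_integral has_bochner_integral_iff)
qed

text \<open>The weight is positive on the open triangle \<open>U\<close>, so \<open>p\<close>
  vanishes almost everywhere there. The subset of \<open>U\<close> where it does not vanish is open
  and null, hence empty.\<close>

lemma inner_definite:
  assumes "inner p p = 0"
  shows "p = 0"
proof -
  define U where "U = {z::real \<times> real. 0 < snd z \<and> snd z < fst z \<and> fst z + snd z < 1}"
  define N where "N = {z \<in> U. eval2 p (fst z) (snd z) \<noteq> 0}"
  have "open U"
    unfolding U_def by (intro open_Collect_conj open_Collect_less continuous_intros)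
  moreover have "open {z. eval2 p (fst z) (snd z) \<noteq> 0}"
    using open_Collect_neq[OF continuous_on_eval2[of p] continuous_on_const[of UNIV 0]] .
  moreover have "N = U \<inter> {z. eval2 p (fst z) (snd z) \<noteq> 0}"
    by (auto simp: N_def)
  ultimately have "open N"
    by (simp add: open_Int)
  have weighted_nonneg: "weighted \<alpha> \<gamma> \<kappa> (p * p) z \<ge> 0" for z
    by (simp add: weighted_def eval2_mult weight_nonneg)
  have pos: "weighted \<alpha> \<gamma> \<kappa> (p * p) z \<noteq> 0" if "z \<in> N" for z
    using that by (auto simp: N_def U_def weighted_def weight_def eval2_mult half_triangle_def T2_def
      case_prod_beta indicator_def)
  have "AE z in lborel. weighted \<alpha> \<gamma> \<kappa> (p * p) z = 0"
    using assms integral_nonneg_eq_0_iff_AE[OF integrable_weighted] weighted_nonneg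
    by (simp add: w_inner_eq_integral)
  then have "AE z in lborel. z \<notin> N"
    by eventually_elim (use pos in auto)
  then have "N \<in> null_sets lborel"
    using \<open>open N\<close> by (subst AE_iff_null_sets) auto
  then have "negligible N"
    by (simp add: negligible_iff_null_sets null_sets_completionI)
  then have "N = {}"
    using \<open>open N\<close> open_not_negligible by blast
  show ?thesis
  \<comment> \<open>For 0 < y < x < 1/2 the sum x + y stays below 1, so these slices lie in
    \<open>U\<close>.\<close>
  proof (rule eval2_eq_0_imp)
    show "infinite {0<..<1/2::real}"
      by (simp add: infinite_Ioo)
    show "infinite {0<..<x}" if "x \<in> {0<..<1/2}" for x :: real
      using that by (simp add: infinite_Ioo)
    show "eval2 p x y = 0" if "x \<in> {0<..<1/2}" "y \<in> {0<..<x}" for x y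
      using \<open>N = {}\<close> that by (auto simp: N_def U_def)
  qed
qed

text \<open>Gram-Schmidt by induction on \<open>S\<close>. With \<open>v\<close> arbitrary, the
  induction hypothesis also projects the new vector \<open>a\<close>, and the residual
  \<open>a - b\<close> supplies the new orthogonal direction.\<close>

lemma exists_orthogonal_projection:
  assumes "finite S"
  shows "\<exists>u\<in>bipoly.span S. \<forall>s\<in>S. inner (v - u) s = 0"
  using assms
proof (induction S arbitrary: v rule: finite_induct)
  case empty
  show ?case by (auto intro: bipoly.span_zero)
next
  case (insert a S)
  obtain u where u: "u \<in> bipoly.span S" "\<forall>s\<in>S. inner (v - u) s = 0"
    using insert.IH by blast
  obtain b where b: "b \<in> bipoly.span S" "\<forall>s\<in>S. inner (a - b) s = 0"
    using insert.IH by blast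
  define c where "c = inner (v - u) (a - b) / inner (a - b) (a - b)"
  define u' where "u' = u + const2 c * (a - b)"
  \<comment> \<open>If the norm of \<open>a - b\<close> is 0, definiteness gives a = b and the
    equation holds whatever the value of the quotient \<open>c\<close>.\<close>
  have c: "inner (v - u) (a - b) = c * inner (a - b) (a - b)"
  proof (cases "inner (a - b) (a - b) = 0")
    case True
    then have "a - b = 0" by (rule inner_definite)
    then show ?thesis
      by (simp only: inner_zero_right)
  qed (simp add: c_def)
  have diff: "inner (v - u') s = inner (v - u) s - c * inner (a - b) s" for s
    using inner_diff_left[of "v - u" "const2 c * (a - b)" s]
    by (simp add: u'_def inner_scale_left diff_diff_eq)
  have S: "inner (v - u') s = 0" if "s \<in> S" for s
    using that u b by (simp add: diff)
  have "inner (v - u') a = inner (v - u') b + inner (v - u') (a - b)"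
    using inner_add_right[of "v - u'" b "a - b"] by simp
  also have "\<dots> = 0"
    using inner_span_eq_0[OF b(1) S] by (simp add: diff c)
  finally have "\<forall>s\<in>insert a S. inner (v - u') s = 0"
    using S by simp
  moreover have "u' \<in> bipoly.span (insert a S)"
  proof -
    have "bipoly.span S \<subseteq> bipoly.span (insert a S)"
      by (rule bipoly.span_mono) auto
    then show ?thesis
      unfolding u'_def using u(1) b(1)
      by (intro bipoly.span_add bipoly.span_scale bipoly.span_diff)
        (auto intro: bipoly.span_base)
  qed
  ultimately show ?case by blast
qed

text \<open>\<open>S\<close> and \<open>K\<close> are unchanged when the two monomials are
  exchanged, so both sides combine the same products of values of \<open>M\<close> and
  \<open>Z\<close>. Only the coefficients differ, and their differences regroup into multiples of
  the two Beta recurrences.\<close>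

lemma inner_D1_sym_monom_commute:
  "inner (D1 \<alpha> \<gamma> \<kappa> (sym_monom i)) (sym_monom j) = inner (sym_monom i) (D1 \<alpha> \<gamma> \<kappa> (sym_monom j))"
proof -
  obtain n k where i: "i = (n, k)" by fastforce
  obtain m l where j: "j = (m, l)" by fastforce
  define M where "M S = Beta (real S + 2 * \<alpha> + 2 * \<kappa> + 3) (\<gamma> + 1)" for S
  define Z where "Z K = Beta (real K + \<alpha> + 1) (\<kappa> + 1) / 4 powr (real K + \<alpha> + 1)" for K
  define S K where "S = n + m + 2 * (k + l)" and "K = k + l"
  have M: "(real S + 2 * \<alpha> + 2 * \<kappa> + \<gamma> + 3) * M S = (real S + 2 * \<alpha> + 2 * \<kappa> + 2) * M (S - 1)" if pos: "S > 0"
  proof -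
    obtain T where "S = Suc T" using gr0_implies_Suc[OF pos] by blast
    then have T: "real S + 2 * \<alpha> + 2 * \<kappa> + 3 = (real T + 2 * \<alpha> + 2 * \<kappa> + 3) + 1" "S - 1 = T"
      by simp_all
    have "real T + 2 * \<alpha> + 2 * \<kappa> + 3 > 0"
      using params by simp
    then have "(real T + 2 * \<alpha> + 2 * \<kappa> + 3 + (\<gamma> + 1)) * M S = (real T + 2 * \<alpha> + 2 * \<kappa> + 3) * M (S - 1)"
      unfolding M_def T by (intro Beta_plus1_left) (auto dest: nonpos_Ints_nonpos)
    then show ?thesis
      using T by (simp add: add_ac)
  qed
  \<comment> \<open>The factor 4 is the step of the power of 4 in the denominator of
    \<open>Z\<close>.\<close>
  have Z: "4 * (real K + \<alpha> + \<kappa> + 1) * Z K = (real K + \<alpha>) * Z (K - 1)" if pos: "K > 0"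
  proof -
    obtain T where "K = Suc T" using gr0_implies_Suc[OF pos] by blast
    then have T: "real K + \<alpha> + 1 = (real T + \<alpha> + 1) + 1" "K - 1 = T"
      by simp_all
    let ?q = "4 powr (real T + \<alpha> + 1)"
    have "real T + \<alpha> + 1 > 0"
      using params by simp
    then have beta: "(real T + \<alpha> + 1 + (\<kappa> + 1)) * Beta (real T + \<alpha> + 1 + 1) (\<kappa> + 1)
        = (real T + \<alpha> + 1) * Beta (real T + \<alpha> + 1) (\<kappa> + 1)"
      by (intro Beta_plus1_left) (auto dest: nonpos_Ints_nonpos)
    have "4 * Z K = Beta (real T + \<alpha> + 1 + 1) (\<kappa> + 1) / ?q"
      unfolding Z_def T by (subst powr_add) simp
    moreover have "Z (K - 1) = Beta (real T + \<alpha> + 1) (\<kappa> + 1) / ?q"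
      unfolding Z_def T ..
    ultimately have "(real T + \<alpha> + 1 + (\<kappa> + 1)) * (4 * Z K) = (real T + \<alpha> + 1) * Z (K - 1)"
      using beta by (simp only: times_divide_eq_right)
    moreover have "real K = real T + 1"
      using T by simp
    ultimately show ?thesis
      by (simp only: add_ac mult_ac)
  qed
  \<comment> \<open>Stated for all indices with the given sums, so that one formula serves for
    either monomial under \<open>D1\<close>. The lowered moments are identified only for positive n'
    or k'; otherwise their coefficient is 0.\<close>
  have expand: "inner (D1 \<alpha> \<gamma> \<kappa> (sym_monom (n', k'))) (sym_monom (m', l')) =
      jacobi_eigenvalue \<alpha> \<gamma> \<kappa> (n', k') * (M S * Z K)
      + real n' * (real n' + 4 * real k' + 2 * \<alpha> + 2 * \<kappa> + 2) * (M (S - 1) * Z K)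
      + real k' * (real k' + \<alpha>) * (M (S - 1) * Z (K - 1))"
    if "n' + m' = n + m" "k' + l' = k + l" for n' k' m' l'
  proof -
    have "moment \<alpha> \<gamma> \<kappa> (n' + m', k' + l') = M S * Z K"
      by (simp add: that moment_def M_def Z_def S_def K_def)
    moreover have "moment \<alpha> \<gamma> \<kappa> (n' - 1 + m', k' + l') = M (S - 1) * Z K" if "n' > 0"
    proof -
      have "n' - 1 + m' + 2 * (k' + l') = S - 1" "k' + l' = K"
        using that \<open>n' + m' = n + m\<close> \<open>k' + l' = k + l\<close> by (auto simp: S_def K_def)
      then show ?thesis
        by (simp only: moment_def prod.case M_def Z_def)
    qed
    moreover have "moment \<alpha> \<gamma> \<kappa> (n' + 1 + m', k' - 1 + l') = M (S - 1) * Z (K - 1)" if "k' > 0"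
    proof -
      have "n' + 1 + m' + 2 * (k' - 1 + l') = S - 1" "k' - 1 + l' = K - 1"
        using that \<open>n' + m' = n + m\<close> \<open>k' + l' = k + l\<close> by (auto simp: S_def K_def)
      then show ?thesis
        by (simp only: moment_def prod.case M_def Z_def)
    qed
    ultimately show ?thesis
      unfolding D1_sym_monom inner_add_left inner_scale_left inner_sym_monom
      by (cases "n' = 0"; cases "k' = 0") simp_all
  qed
  have S: "real S = (real n + 2 * real k) + (real m + 2 * real l)" and K: "real K = real k + real l"
    by (simp_all add: S_def K_def)
  let ?ev = "jacobi_eigenvalue \<alpha> \<gamma> \<kappa>"
  let ?A = "\<lambda>n k. real n * (real n + 4 * real k + 2 * \<alpha> + 2 * \<kappa> + 2)"
  let ?B = "\<lambda>k. real k * (real k + \<alpha>)"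
  let ?d = "(real n + 2 * real k) - (real m + 2 * real l)" and ?e = "real k - real l"
  have ev: "?ev (n, k) - ?ev (m, l) = - ?d * (real S + 2 * \<alpha> + 2 * \<kappa> + \<gamma> + 3)"
    unfolding S jacobi_eigenvalue_def prod.case by (simp add: algebra_simps)
  \<comment> \<open>With N = n + 2k and c = 2\<alpha> + 2\<kappa> + 2, the coefficient n(n + 4k + c)
    equals N(N + c) - 4k(k + c/2). Differencing the two terms produces the factors \<open>?d\<close>
    and \<open>?e\<close>.\<close>
  have A: "?A n k - ?A m l = ?d * (real S + 2 * \<alpha> + 2 * \<kappa> + 2) - 4 * ?e * (real K + \<alpha> + \<kappa> + 1)"
    unfolding S K by (simp add: algebra_simps)
  have B: "?B k - ?B l = ?e * (real K + \<alpha>)"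
    unfolding K by (simp add: algebra_simps)
  have "inner (D1 \<alpha> \<gamma> \<kappa> (sym_monom i)) (sym_monom j) - inner (sym_monom i) (D1 \<alpha> \<gamma> \<kappa> (sym_monom j)) =
      (?ev (n, k) - ?ev (m, l)) * (M S * Z K) + (?A n k - ?A m l) * (M (S - 1) * Z K)
      + (?B k - ?B l) * (M (S - 1) * Z (K - 1))"
    unfolding inner_commute[of "sym_monom i"] unfolding i j expand[OF refl refl]
      expand[OF add.commute add.commute]
    by (simp only: left_diff_distrib)
  also have "\<dots> = ?d * Z K
        * ((real S + 2 * \<alpha> + 2 * \<kappa> + 2) * M (S - 1) - (real S + 2 * \<alpha> + 2 * \<kappa> + \<gamma> + 3) * M S)
      + ?e * M (S - 1) * ((real K + \<alpha>) * Z (K - 1) - 4 * (real K + \<alpha> + \<kappa> + 1) * Z K)"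
  proof -
    have regroup: "- d * c * (m1 * z1) + (d * a - 4 * e * b) * (m0 * z1) + e * f * (m0 * z0) =
        d * z1 * (a * m0 - c * m1) + e * m0 * (f * z0 - 4 * b * z1)"
      for a b c d e f m0 m1 z0 z1 :: real
      by (simp add: algebra_simps)
    show ?thesis
      unfolding ev A B by (rule regroup)
  qed
  also have "\<dots> = 0"
  proof -
    have "S = 0 \<Longrightarrow> (real n + 2 * real k) - (real m + 2 * real l) = 0" "K = 0 \<Longrightarrow> real k - real l = 0"
      by (simp_all add: S_def K_def)
    then show ?thesis
      using M Z by (cases "S = 0"; cases "K = 0") simp_all
  qed
  finally show ?thesis by simp
qed

lemma inner_D1_commute:
  assumes "p \<in> bipoly.span (range sym_monom)"
  shows "inner (D1 \<alpha> \<gamma> \<kappa> p) (sym_monom j) = inner p (D1 \<alpha> \<gamma> \<kappa> (sym_monom j))"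
  using assms
proof (induction rule: span_sym_monom_induct)
  case zero
  show ?case by (simp add: D1_zero inner_zero_left)
next
  case (step c i q)
  then show ?case
    by (simp add: D1_add D1_scale symmetric2_sym_monom symmetric2_scale inner_add_left
      inner_scale_left inner_D1_sym_monom_commute)
qed

section \<open>Existence and uniqueness of the basis, and the eigenvalue equation\<close>

lemma is_monic_sop_iff:
  "is_monic_sop \<alpha> \<gamma> \<kappa> n k p \<longleftrightarrow>
     p - sym_monom (n, k) \<in> bipoly.span (sym_monom ` {i. i \<prec> (n, k)})
     \<and> (\<forall>i. i \<prec> (n, k) \<longrightarrow> inner p (sym_monom i) = 0)"
proof
  assume "is_monic_sop \<alpha> \<gamma> \<kappa> n k p"
  then show "p - sym_monom (n, k) \<in> bipoly.span (sym_monom ` {i. i \<prec> (n, k)})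
     \<and> (\<forall>i. i \<prec> (n, k) \<longrightarrow> inner p (sym_monom i) = 0)"
    unfolding is_monic_sop_def span_sym_monom_iff
    using symmetric2_sym_monom has_sym_degree_sym_monom by blast
next
  assume p: "p - sym_monom (n, k) \<in> bipoly.span (sym_monom ` {i. i \<prec> (n, k)})
     \<and> (\<forall>i. i \<prec> (n, k) \<longrightarrow> inner p (sym_monom i) = 0)"
  have "symmetric2 (p - sym_monom (n, k) + sym_monom (n, k))"
    using p by (intro symmetric2_add symmetric2_sym_monom span_sym_monom_symmetric2) auto
  \<comment> \<open>By transitivity every monomial in \<open>q\<close> lies below (n, k), so
    linearity extends orthogonality from monomials to \<open>q\<close>.\<close>
  moreover have "inner p q = 0" if "has_sym_degree q d" "d \<prec> (n, k)" for q d
    using has_sym_degree_imp_span[OF that(1)]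
    by (rule inner_span_eq_0) (use p that(2) sdeg_less_trans[OF _ that(2)] in blast)
  ultimately show "is_monic_sop \<alpha> \<gamma> \<kappa> n k p"
    using p unfolding is_monic_sop_def span_sym_monom_iff by auto
qed

text \<open>Such a \<open>p\<close> is orthogonal to itself. This closes both the uniqueness proof
  and the eigenvalue equation.\<close>

lemma span_orthogonal_eq_0:
  assumes "p \<in> bipoly.span S" and "\<And>s. s \<in> S \<Longrightarrow> inner p s = 0"
  shows "p = 0"
  using assms inner_definite inner_span_eq_0 by blast

text \<open>Existence subtracts from the leading monomial its projection onto the lower ones. In a
  difference of two candidates the leading monomials cancel, which leaves a lower polynomial
  orthogonal to all lower monomials.\<close>

lemma is_monic_sop_monic_sop: "is_monic_sop \<alpha> \<gamma> \<kappa> n k (monic_sop \<alpha> \<gamma> \<kappa> n k)"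
  unfolding monic_sop_def
proof (rule theI')
  let ?L = "sym_monom ` {i. i \<prec> (n, k)}"
  show "\<exists>!p. is_monic_sop \<alpha> \<gamma> \<kappa> n k p"
  proof (rule ex_ex1I)
    have "finite ?L"
      using finite_sdeg_less by blast
    then obtain u where "u \<in> bipoly.span ?L" "\<forall>s\<in>?L. inner (sym_monom (n, k) - u) s = 0"
      using exists_orthogonal_projection by blast
    then have "is_monic_sop \<alpha> \<gamma> \<kappa> n k (sym_monom (n, k) - u)"
      unfolding is_monic_sop_iff using bipoly.span_neg[of u ?L] by simp
    then show "\<exists>p. is_monic_sop \<alpha> \<gamma> \<kappa> n k p" ..
  next
    fix p q
    assume pq: "is_monic_sop \<alpha> \<gamma> \<kappa> n k p" "is_monic_sop \<alpha> \<gamma> \<kappa> n k q"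
    then have "(p - sym_monom (n, k)) - (q - sym_monom (n, k)) \<in> bipoly.span ?L"
      unfolding is_monic_sop_iff by (blast intro: bipoly.span_diff)
    then have "p - q \<in> bipoly.span ?L"
      by simp
    then have "p - q = 0"
      by (rule span_orthogonal_eq_0) (use pq in \<open>auto simp: is_monic_sop_iff inner_diff_left\<close>)
    then show "p = q" by simp
  qed
qed

lemma D1_monic_sop:
  "D1 \<alpha> \<gamma> \<kappa> (monic_sop \<alpha> \<gamma> \<kappa> n k) =
    const2 (jacobi_eigenvalue \<alpha> \<gamma> \<kappa> (n, k)) * monic_sop \<alpha> \<gamma> \<kappa> n k"
proof -
  define d where "d = (n, k)"
  define p where "p = monic_sop \<alpha> \<gamma> \<kappa> n k"
  define ev where "ev = jacobi_eigenvalue \<alpha> \<gamma> \<kappa> d"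
  let ?L = "sym_monom ` {i. i \<prec> d}"
  let ?r = "D1 \<alpha> \<gamma> \<kappa> p - const2 ev * p"
  have lower: "p - sym_monom d \<in> bipoly.span ?L"
    and orth: "\<And>i. i \<prec> d \<Longrightarrow> inner p (sym_monom i) = 0"
    using is_monic_sop_monic_sop[of n k] by (auto simp: is_monic_sop_iff p_def d_def)
  have "bipoly.span ?L \<subseteq> bipoly.span (range sym_monom)"
    by (rule bipoly.span_mono) auto
  then have span: "p \<in> bipoly.span (range sym_monom)"
    using bipoly.span_add[of "p - sym_monom d" "range sym_monom" "sym_monom d"] lower
      bipoly.span_base[of "sym_monom d" "range sym_monom"] by auto
  have "?r = 0"
  proof (rule span_orthogonal_eq_0)
    have "D1 \<alpha> \<gamma> \<kappa> ((p - sym_monom d) + sym_monom d) =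
        D1 \<alpha> \<gamma> \<kappa> (p - sym_monom d) + D1 \<alpha> \<gamma> \<kappa> (sym_monom d)"
      by (intro D1_add symmetric2_sym_monom span_sym_monom_symmetric2[OF lower])
    \<comment> \<open>The eigenvalue is the diagonal coefficient of \<open>D1\<close> at
      \<open>d\<close>, so the leading monomial drops out and three lower pieces remain.\<close>
    then have "?r = D1 \<alpha> \<gamma> \<kappa> (p - sym_monom d)
        + (D1 \<alpha> \<gamma> \<kappa> (sym_monom d) - const2 ev * sym_monom d) - const2 ev * (p - sym_monom d)"
      by (simp add: algebra_simps)
    also have "\<dots> \<in> bipoly.span ?L"
      unfolding ev_def by (intro bipoly.span_add bipoly.span_diff bipoly.span_scale
        D1_minus_in_span D1_sym_monom_minus_in_span lower)
    finally show "?r \<in> bipoly.span ?L" .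
  next
    fix s assume "s \<in> ?L"
    then obtain i where i: "i \<prec> d" "s = sym_monom i" by auto
    \<comment> \<open>\<open>D1\<close> preserves the lower span, so moving it onto \<open>s\<close>
      stays within the range where \<open>p\<close> is orthogonal.\<close>
    have "D1 \<alpha> \<gamma> \<kappa> s \<in> bipoly.span ?L"
      using i by (intro D1_minus_in_span bipoly.span_base) auto
    then have "inner p (D1 \<alpha> \<gamma> \<kappa> s) = 0"
      by (rule inner_span_eq_0) (use orth in auto)
    then show "inner ?r s = 0"
      using orth[OF i(1)] inner_D1_commute[OF span] by (simp add: i(2) inner_diff_left inner_scale_left)
  qed
  then show ?thesis
    by (simp add: p_def ev_def d_def)
qed

end

theorem theorem4p3:
  fixes \<alpha> \<gamma> \<kappa> :: real and n k :: nat
  assumes "\<alpha> > -1" and "\<gamma> > -1" and "\<kappa> > -1" and "\<alpha> + \<kappa> > -3/2"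
  shows "D1 \<alpha> \<gamma> \<kappa> (monic_sop \<alpha> \<gamma> \<kappa> n k) =
    const2 (- (real n + 2 * real k) * (real n + 2 * real k + 2 * \<alpha> + 2 * \<kappa> + \<gamma> + 3))
      * monic_sop \<alpha> \<gamma> \<kappa> n k"
proof -
  interpret jacobi_triangle \<alpha> \<gamma> \<kappa>
    by unfold_locales (use assms in auto)
  show ?thesis
    using D1_monic_sop[of n k] by (simp add: jacobi_eigenvalue_def)
qed

end
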